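(* Let $\tau>0$ and let $\Sigma$ be a continuous-time control system $\dot x(t)=f(x(t),u(t))$, $y(t)=h(x(t),u(t))$ with state in $\mathbb{R}^n$ and input and output of the same dimension $m$. Suppose that: (A1) the output function has the additive form $h(x,u)=h_1(x)+h_2(u)$; (A2) there exist a constant $\gamma>0$ and a function $\beta:\mathbb{R}^n\to\mathbb{R}_{\ge 0}$ with $\beta(\mathbf 0)=0$ such that for any initial state $x_0\in\mathbb{R}^n$, any $T>0$ and any admissible input $u(t)$, $$\int_0^T|\dot h_1(x(t))|^2\,dt\le \gamma^2\int_0^T|u(t)|^2\,dt+\beta(x_0).$$ Suppose further that $\Sigma$ is IF-OFP$(\nu,\rho)$ with a positive semi-definite storage function $V(x)$. Let $\lambda_1>0$ be an arbitrary positive number. Then the time-sampled system $T_\tau(\Sigma)$ satisfies, for any $k_0,k_1\in\mathbb{Z}_{\ge 0}$ with $k_0<k_1$ and any admissible inputs, $$\hat V(x[k_1])-\hat V(x[k_0])\le \delta(x[k_0])+\sum_{k=k_0}^{k_1-1}\left(u[k]^\top y[k]-\nu'|u[k]|^2-\rho'|y[k]|^2\right),$$ where $\hat V(x)=\frac1\tau V(x)$ and $$\nu'=\nu-\tau\gamma-\tau^2\gamma^2(1+\lambda_1)|\rho|,\qquad \rho'=\rho-\frac{|\rho|}{\lambda_1},$$ $$\delta(x[k_0])=w\,\beta(x[k_0]),\qquad w=|\rho|\tau(1+\lambda_1)+\frac1\gamma .$$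
   Context: $|\cdot|$ is the Euclidean norm. Continuous-time control system: $\Sigma$ has state set $\mathbb{R}^n$, input set $U\subseteq\mathbb{R}^m$, output set $\mathbb{R}^m$; $f:\mathbb{R}^n\times U\to\mathbb{R}^n$ is Lipschitz continuous, $h$ is continuous, $f(0,0)=0$, $h(0,0)=0$. For any sufficiently regular (admissible) input signal on $[0,T]$ and any initial state there exist a unique state trajectory and a corresponding output trajectory on $[0,T]$. Write $\mathbf{x}(\tau,x_0,\mathbf{u})$ for the state reached at time $\tau$ from $x_0$ under input $\mathbf u$. Piecewise constant inputs are admissible. IF-OFP$(\nu,\rho)$ ($\nu,\rho\in\mathbb{R}$) with storage function $V$: $V$ is positive semi-definite and for any initial state $x(t_0)$, any $0\le t_0<t_1$ and any admissible input, $V(x(t_1))-V(x(t_0))\le\int_{t_0}^{t_1}\left(u(s)^\top y(s)-\nu|u(s)|^2-\rho|y(s)|^2\right)ds$. $T_\tau(\Sigma)$ is the discrete-time system obtained from $\Sigma$ by a zero-order hold and uniform sampling with period $\tau$: $x[k+1]=\mathbf{x}(\tau,x[k],\mathbf u)$ where $\mathbf u$ is constantly equal to $u[k]\in U$ on $[0,\tau)$, and $y[k]=h(x[k],u[k])$. *)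

theory Defs
  imports "HOL-Analysis.Analysis"
begin

(* A signal is a function on the whole real line; only its values on [0,T] matter. Likewise
   only the values of f, h and h2 at inputs in U matter. *)
type_synonym 'a signal = "real \<Rightarrow> 'a"

(* Solutions of x' = f(x,u) are taken in the sense of Caratheodory, since u may jump. *)
definition trajectory ::
  "(real^'n \<Rightarrow> real^'m \<Rightarrow> real^'n) \<Rightarrow> real \<Rightarrow> real^'n \<Rightarrow> (real^'m) signal \<Rightarrow> (real^'n) signal \<Rightarrow> bool"
  where
  "trajectory f T x0 u x \<longleftrightarrow>
     (\<lambda>s. f (x s) (u s)) absolutely_integrable_on {0..T} \<and>
     (\<forall>t\<in>{0..T}. x t = x0 + integral {0..t} (\<lambda>s. f (x s) (u s)))"

definition piecewise_constant_on :: "real \<Rightarrow> 'a signal \<Rightarrow> bool" where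
  "piecewise_constant_on T u \<longleftrightarrow>
     (\<exists>(N::nat) p. p 0 = 0 \<and> p N = T \<and>
        (\<forall>i<N. p i < p (Suc i) \<and> (\<exists>c. \<forall>t\<in>{p i..<p (Suc i)}. u t = c)))"

(* The class of admissible inputs is a parameter: Adm T u says that u is admissible on [0,T].
   The assumptions adm_measurable, adm_input_L2 and adm_output_L2 make "sufficiently regular"
   precise: all integrals of supply rates along trajectories exist. *)
locale control_system =
  fixes U :: "(real^'m) set"
    and f :: "real^'n \<Rightarrow> real^'m \<Rightarrow> real^'n"
    and h :: "real^'n \<Rightarrow> real^'m \<Rightarrow> real^'m"
    and Adm :: "real \<Rightarrow> (real^'m) signal \<Rightarrow> bool"
  assumes zero_input: "0 \<in> U"
    and f_lipschitz: "\<exists>L. L-lipschitz_on (UNIV \<times> U) (\<lambda>(x, u). f x u)"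
    and h_continuous: "continuous_on (UNIV \<times> U) (\<lambda>(x, u). h x u)"
    and f_zero: "f 0 0 = 0"
    and h_zero: "h 0 0 = 0"
    and adm_range: "\<And>T u t. T > 0 \<Longrightarrow> Adm T u \<Longrightarrow> t \<in> {0..T} \<Longrightarrow> u t \<in> U"
    and adm_piecewise_constant:
      "\<And>T u. T > 0 \<Longrightarrow> piecewise_constant_on T u \<Longrightarrow> (\<And>t. t \<in> {0..T} \<Longrightarrow> u t \<in> U) \<Longrightarrow> Adm T u"
    and adm_measurable: "\<And>T u. T > 0 \<Longrightarrow> Adm T u \<Longrightarrow> u \<in> borel_measurable (lebesgue_on {0..T})"
    and adm_input_L2: "\<And>T u. T > 0 \<Longrightarrow> Adm T u \<Longrightarrow> (\<lambda>t. (norm (u t))\<^sup>2) integrable_on {0..T}"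
    and adm_output_L2:
      "\<And>T u x0 x. T > 0 \<Longrightarrow> Adm T u \<Longrightarrow> trajectory f T x0 u x \<Longrightarrow>
         (\<lambda>t. (norm (h (x t) (u t)))\<^sup>2) integrable_on {0..T}"
    and trajectory_exists: "\<And>T u x0. T > 0 \<Longrightarrow> Adm T u \<Longrightarrow> \<exists>x. trajectory f T x0 u x"
    and trajectory_unique:
      "\<And>T u x0 x x' t. T > 0 \<Longrightarrow> Adm T u \<Longrightarrow> trajectory f T x0 u x \<Longrightarrow> trajectory f T x0 u x' \<Longrightarrow>
         t \<in> {0..T} \<Longrightarrow> x t = x' t"

definition state_at ::
  "(real^'n \<Rightarrow> real^'m \<Rightarrow> real^'n) \<Rightarrow> real \<Rightarrow> real^'n \<Rightarrow> (real^'m) signal \<Rightarrow> real^'n" where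
  "state_at f T x0 u = (THE z. \<exists>x. trajectory f T x0 u x \<and> x T = z)"

definition pos_semidef :: "(real^'n \<Rightarrow> real) \<Rightarrow> bool" where
  "pos_semidef V \<longleftrightarrow> V 0 = 0 \<and> (\<forall>x. V x \<ge> 0)"

definition IF_OFP ::
  "(real^'n \<Rightarrow> real^'m \<Rightarrow> real^'n) \<Rightarrow> (real^'n \<Rightarrow> real^'m \<Rightarrow> real^'m) \<Rightarrow>
   (real \<Rightarrow> (real^'m) signal \<Rightarrow> bool) \<Rightarrow> real \<Rightarrow> real \<Rightarrow> (real^'n \<Rightarrow> real) \<Rightarrow> bool" where
  "IF_OFP f h Adm \<nu> \<rho> V \<longleftrightarrow>
     pos_semidef V \<and>
     (\<forall>T x0 u x t0 t1. T > 0 \<longrightarrow> Adm T u \<longrightarrow> trajectory f T x0 u x \<longrightarrow>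
        0 \<le> t0 \<longrightarrow> t0 < t1 \<longrightarrow> t1 \<le> T \<longrightarrow>
        V (x t1) - V (x t0) \<le>
          integral {t0..t1} (\<lambda>s. u s \<bullet> h (x s) (u s) - \<nu> * (norm (u s))\<^sup>2
                                   - \<rho> * (norm (h (x s) (u s)))\<^sup>2))"

(* y is absolutely continuous on [0,T]: its derivative, which exists almost everywhere, is
   Lebesgue integrable and y is recovered from it. (An almost everywhere derivative alone would
   not do: think of the Cantor function.) *)
definition integral_of_derivative :: "real \<Rightarrow> ('a::euclidean_space) signal \<Rightarrow> bool" where
  "integral_of_derivative T y \<longleftrightarrow>
     (AE t in lebesgue_on {0..T}. y differentiable (at t)) \<and>
     (\<lambda>t. vector_derivative y (at t)) absolutely_integrable_on {0..T} \<and>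
     (\<forall>t\<in>{0..T}. y t = y 0 + integral {0..t} (\<lambda>s. vector_derivative y (at s)))"

(* The bound on the time derivative of h1(x(t)). The first two conjuncts say that this derivative
   makes sense along trajectories and is square integrable; they hold e.g. for h1 of class C1 and
   bounded inputs. Without the second one, integral would silently be 0. *)
definition output_rate_bound ::
  "(real^'n \<Rightarrow> real^'m \<Rightarrow> real^'n) \<Rightarrow> (real \<Rightarrow> (real^'m) signal \<Rightarrow> bool) \<Rightarrow>
   (real^'n \<Rightarrow> real^'m) \<Rightarrow> real \<Rightarrow> (real^'n \<Rightarrow> real) \<Rightarrow> bool" where
  "output_rate_bound f Adm h1 \<gamma> \<beta> \<longleftrightarrow>
     (\<forall>T x0 u x. T > 0 \<longrightarrow> Adm T u \<longrightarrow> trajectory f T x0 u x \<longrightarrow>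
        integral_of_derivative T (\<lambda>t. h1 (x t)) \<and>
        (\<lambda>t. (norm (vector_derivative (\<lambda>s. h1 (x s)) (at t)))\<^sup>2) integrable_on {0..T} \<and>
        integral {0..T} (\<lambda>t. (norm (vector_derivative (\<lambda>s. h1 (x s)) (at t)))\<^sup>2)
          \<le> \<gamma>\<^sup>2 * integral {0..T} (\<lambda>t. (norm (u t))\<^sup>2) + \<beta> x0)"

(* The input/state/output sequences of the system sampled with period \<tau> under a zero-order hold. *)
definition sampled_run ::
  "(real^'m) set \<Rightarrow> (real^'n \<Rightarrow> real^'m \<Rightarrow> real^'n) \<Rightarrow> (real^'n \<Rightarrow> real^'m \<Rightarrow> real^'m) \<Rightarrow>
   real \<Rightarrow> (nat \<Rightarrow> real^'m) \<Rightarrow> (nat \<Rightarrow> real^'n) \<Rightarrow> (nat \<Rightarrow> real^'m) \<Rightarrow> bool" where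
  "sampled_run U f h \<tau> u x y \<longleftrightarrow>
     (\<forall>k. u k \<in> U \<and> x (Suc k) = state_at f \<tau> (x k) (\<lambda>_. u k) \<and> y k = h (x k) (u k))"

end

theory Submission
  imports Defs
begin

text \<open>
  Apply the sampled input to the continuous system through a zero-order hold, starting from
  \<open>x[k\<^sub>0]\<close>; its trajectory passes through the sampled states at the sampling instants. During one
  period the output of the continuous system is the sampled output \<open>y[k]\<close> plus the drift
  \<open>e(t) = h\<^sub>1(x(t)) - h\<^sub>1(x(k \<tau>))\<close>: since the input is constant there, the feedthrough part of the
  output cancels. So dissipativity of the continuous system gives dissipativity of the samples up
  to the cost of replacing \<open>y[k] + e(t)\<close> by \<open>y[k]\<close> in the supply rate
  (\<open>supply_rate_perturbed_output\<close>).

  Young's inequality turns this cost into multiples of \<open>|u[k]|\<^sup>2\<close>, \<open>|y[k]|\<^sup>2\<close> and \<open>|e(t)|\<^sup>2\<close>. The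
  first two change the passivity indices directly. For the third, the Cauchy-Schwarz inequality bounds
  \<open>|e(t)|\<^sup>2\<close> by \<open>\<tau>\<close> times the integral of the squared output rate over the period
  (\<open>norm_increment_squared_le\<close>), so integrating it costs a further factor \<open>\<tau>\<close>. Only the sum of these
  integrals over all periods matters, and the gain assumption bounds it by \<open>\<gamma>\<^sup>2\<close> times the input
  energy, that is by \<open>\<gamma>\<^sup>2 \<tau> \<Sum> |u[k]|\<^sup>2\<close>, plus \<open>\<beta>(x[k\<^sub>0])\<close>. This is why \<open>\<beta>\<close> enters once, at the
  initial state, and not once per period.

  In the estimate of \<open>u[k] \<bullet> e(t)\<close> the weight \<open>\<tau> \<gamma>\<close> makes the two resulting multiples of the input
  energy equal, each with coefficient \<open>\<tau> \<gamma> / 2\<close>; together they are the loss \<open>\<tau> \<gamma>\<close> in \<open>\<nu>'\<close>. The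
  offset this leaves is \<open>\<beta>(x[k\<^sub>0]) / (2 \<gamma>)\<close>, which is at most the claimed \<open>\<beta>(x[k\<^sub>0]) / \<gamma>\<close>.
\<close>

section \<open>Averages and increments\<close>

text \<open>The square of a mean is at most the mean of the squares, because the variance is nonnegative.\<close>

lemma integral_squared_le:
  fixes g :: "real \<Rightarrow> real"
  assumes "a \<le> b" and g: "g integrable_on {a..b}" and g2: "(\<lambda>t. (g t)\<^sup>2) integrable_on {a..b}"
  shows "(integral {a..b} g)\<^sup>2 \<le> (b - a) * integral {a..b} (\<lambda>t. (g t)\<^sup>2)"
proof (cases "a = b")
  case False
  then have "b - a > 0" using assms by simp
  define m where "m = integral {a..b} g / (b - a)"
  have m: "integral {a..b} g = m * (b - a)" using \<open>b - a > 0\<close> by (simp add: m_def)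
  \<comment> \<open>The integrand is the expanded square of the deviation from the mean.\<close>
  have "((\<lambda>t. (g t)\<^sup>2 - 2 * m * g t + m\<^sup>2) has_integral
      integral {a..b} (\<lambda>t. (g t)\<^sup>2) - 2 * m * integral {a..b} g + (b - a) * m\<^sup>2) {a..b}"
    using has_integral_const_real[of "m\<^sup>2" a b] \<open>a \<le> b\<close>
    by (intro has_integral_add has_integral_diff has_integral_mult_right integrable_integral g g2) auto
  then have "0 \<le> integral {a..b} (\<lambda>t. (g t)\<^sup>2) - 2 * m * integral {a..b} g + (b - a) * m\<^sup>2"
  proof (rule has_integral_nonneg)
    fix t
    show "0 \<le> (g t)\<^sup>2 - 2 * m * g t + m\<^sup>2"
      using zero_le_power2[of "g t - m"] by (simp add: power2_diff algebra_simps)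
  qed
  then have "(b - a) * m\<^sup>2 \<le> integral {a..b} (\<lambda>t. (g t)\<^sup>2)"
    unfolding m by (simp add: power2_eq_square algebra_simps)
  then have "(b - a) * ((b - a) * m\<^sup>2) \<le> (b - a) * integral {a..b} (\<lambda>t. (g t)\<^sup>2)"
    using \<open>b - a > 0\<close> by simp
  then show ?thesis unfolding m by (simp add: power2_eq_square algebra_simps)
qed simp

lemma integral_of_derivative_diff:
  fixes y :: "('a::euclidean_space) signal"
  assumes y: "integral_of_derivative T y" and "0 \<le> a" "a \<le> t" "t \<le> T"
  shows "y t - y a = integral {a..t} (\<lambda>s. vector_derivative y (at s))"
proof -
  let ?D = "\<lambda>s. vector_derivative y (at s)"
  have "?D absolutely_integrable_on {0..T}" using y unfolding integral_of_derivative_def by blast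
  then have "?D integrable_on {0..t}"
    using assms by (auto simp: absolutely_integrable_on_def intro: integrable_subinterval_real)
  then have "integral {0..a} ?D + integral {a..t} ?D = integral {0..t} ?D"
    using assms by (intro Henstock_Kurzweil_Integration.integral_combine) auto
  moreover have "\<forall>s\<in>{0..T}. y s = y 0 + integral {0..s} ?D"
    using y unfolding integral_of_derivative_def by blast
  then have "y t = y 0 + integral {0..t} ?D" "y a = y 0 + integral {0..a} ?D"
    using assms by (meson atLeastAtMost_iff order_trans)+
  ultimately show ?thesis by (metis add_diff_cancel_left add_diff_cancel_left')
qed

lemma integral_of_derivative_continuous_on:
  fixes y :: "('a::euclidean_space) signal"
  assumes "integral_of_derivative T y"
  shows "continuous_on {0..T} y"
proof -
  let ?D = "\<lambda>s. vector_derivative y (at s)"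
  have "continuous_on {0..T} (\<lambda>t. y 0 + integral {0..t} ?D)"
    using assms unfolding integral_of_derivative_def
    by (intro continuous_intros indefinite_integral_continuous_1)
      (simp add: absolutely_integrable_on_def)
  moreover have "\<And>t. t \<in> {0..T} \<Longrightarrow> y 0 + integral {0..t} ?D = y t"
    using assms unfolding integral_of_derivative_def by metis
  ultimately show ?thesis by (rule continuous_on_eq)
qed

text \<open>
  The bound holds with the integral over the whole interval, so that it is uniform in \<open>t\<close> and can be
  integrated over a sampling period as a constant.
\<close>

lemma norm_increment_squared_le:
  fixes y :: "('a::euclidean_space) signal"
  assumes y: "integral_of_derivative T y"
    and sq: "(\<lambda>t. (norm (vector_derivative y (at t)))\<^sup>2) integrable_on {0..T}"
    and ord: "0 \<le> a" "a \<le> t" "t \<le> b" "b \<le> T"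
  shows "(norm (y t - y a))\<^sup>2 \<le> (b - a) * integral {a..b} (\<lambda>s. (norm (vector_derivative y (at s)))\<^sup>2)"
proof -
  let ?D = "\<lambda>s. vector_derivative y (at s)"
  have D: "?D absolutely_integrable_on {a..t}"
    using y ord unfolding integral_of_derivative_def
    by (meson absolutely_integrable_on_subinterval atLeastatMost_subset_iff order_trans)
  have nD: "(\<lambda>s. norm (?D s)) integrable_on {a..t}" and D': "?D integrable_on {a..t}"
    using D by (auto simp: absolutely_integrable_on_def)
  have sq_t: "(\<lambda>s. (norm (?D s))\<^sup>2) integrable_on {a..t}"
    and sq_b: "(\<lambda>s. (norm (?D s))\<^sup>2) integrable_on {a..b}"
    using ord by (auto intro: integrable_subinterval_real[OF sq])
  have mono: "integral {a..t} (\<lambda>s. (norm (?D s))\<^sup>2) \<le> integral {a..b} (\<lambda>s. (norm (?D s))\<^sup>2)"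
    using ord by (intro integral_subset_le sq_t sq_b) auto
  have "norm (y t - y a) \<le> integral {a..t} (\<lambda>s. norm (?D s))"
    unfolding integral_of_derivative_diff[OF y ord(1,2) order_trans[OF ord(3,4)]]
    by (intro integral_norm_bound_integral D' nD) auto
  then have "(norm (y t - y a))\<^sup>2 \<le> (integral {a..t} (\<lambda>s. norm (?D s)))\<^sup>2"
    by (intro power_mono) auto
  also have "\<dots> \<le> (t - a) * integral {a..t} (\<lambda>s. (norm (?D s))\<^sup>2)"
    by (intro integral_squared_le ord nD sq_t)
  also have "\<dots> \<le> (b - a) * integral {a..b} (\<lambda>s. (norm (?D s))\<^sup>2)"
    using ord by (intro mult_mono mono integral_nonneg sq_t) auto
  finally show ?thesis .
qed

lemma has_integral_equal_steps:
  fixes F :: "real \<Rightarrow> 'a::banach"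
  assumes "\<tau> \<ge> 0" and "\<And>i. i < N \<Longrightarrow> (F has_integral I i) {real i * \<tau>..real (Suc i) * \<tau>}"
  shows "(F has_integral (\<Sum>i<N. I i)) {0..real N * \<tau>}"
  using assms(2)
proof (induction N)
  case 0
  then show ?case using has_integral_refl(1)[of F "0::real"] by simp
next
  case (Suc N)
  have "real N * \<tau> \<le> real (Suc N) * \<tau>" using assms(1) by (intro mult_right_mono) auto
  then have "(F has_integral (\<Sum>i<N. I i) + I N) {0..real (Suc N) * \<tau>}"
    using assms(1) Suc by (intro has_integral_combine[of 0 "real N * \<tau>"]) auto
  then show ?case by simp
qed

section \<open>Perturbing the output in the supply rate\<close>

lemma two_mult_le_weighted_squares:
  fixes p q c :: real
  assumes "c > 0"
  shows "2 * p * q \<le> c * p\<^sup>2 + q\<^sup>2 / c"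
proof -
  have "0 \<le> (c * p - q)\<^sup>2 / c" using assms by simp
  also have "(c * p - q)\<^sup>2 / c = c * p\<^sup>2 + q\<^sup>2 / c - 2 * p * q"
    using assms by (simp add: power2_eq_square field_simps)
  finally show ?thesis by simp
qed

text \<open>
  Young's inequality absorbs the two terms linear in \<open>e\<close>: \<open>v \<bullet> e\<close> with weight \<open>c\<close>, and
  \<open>\<rho> (2 \<eta> \<bullet> e)\<close> with weight \<open>l\<close>. As \<open>\<rho>\<close> may have either sign, its effect on the perturbation is
  estimated through \<open>|\<rho>|\<close>, while \<open>- \<rho> |\<eta>|\<^sup>2\<close> is kept exactly.
\<close>

lemma supply_rate_perturbed_output:
  fixes v \<eta> e :: "'a::real_inner"
  assumes "c > 0" and "l > 0"
  shows "v \<bullet> (\<eta> + e) - \<nu> * (norm v)\<^sup>2 - \<rho> * (norm (\<eta> + e))\<^sup>2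
    \<le> v \<bullet> \<eta> - (\<nu> - c / 2) * (norm v)\<^sup>2 - (\<rho> - \<bar>\<rho>\<bar> / l) * (norm \<eta>)\<^sup>2
      + (1 / (2 * c) + \<bar>\<rho>\<bar> * (1 + l)) * (norm e)\<^sup>2"
proof -
  have "2 * (v \<bullet> e) \<le> 2 * norm v * norm e"
    using norm_cauchy_schwarz[of v e] by simp
  also have "\<dots> \<le> c * (norm v)\<^sup>2 + (norm e)\<^sup>2 / c"
    by (rule two_mult_le_weighted_squares[OF assms(1)])
  finally have cross: "v \<bullet> e \<le> c / 2 * (norm v)\<^sup>2 + 1 / (2 * c) * (norm e)\<^sup>2"
    by (simp add: field_simps)
  have "\<bar>2 * (\<eta> \<bullet> e) + (norm e)\<^sup>2\<bar> \<le> 2 * norm e * norm \<eta> + (norm e)\<^sup>2"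
    using Cauchy_Schwarz_ineq2[of \<eta> e] zero_le_power2[of "norm e"]
      mult.commute[of "norm \<eta>" "norm e"]
    unfolding abs_le_iff by linarith
  also have "\<dots> \<le> (norm \<eta>)\<^sup>2 / l + (1 + l) * (norm e)\<^sup>2"
    using two_mult_le_weighted_squares[OF assms(2), of "norm e" "norm \<eta>"] by (simp add: algebra_simps)
  finally have "\<bar>\<rho>\<bar> * \<bar>2 * (\<eta> \<bullet> e) + (norm e)\<^sup>2\<bar> \<le> \<bar>\<rho>\<bar> * ((norm \<eta>)\<^sup>2 / l + (1 + l) * (norm e)\<^sup>2)"
    by (intro mult_left_mono) auto
  moreover have "- \<rho> * (2 * (\<eta> \<bullet> e) + (norm e)\<^sup>2) \<le> \<bar>\<rho>\<bar> * \<bar>2 * (\<eta> \<bullet> e) + (norm e)\<^sup>2\<bar>"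
    by (metis abs_ge_self abs_minus_cancel abs_mult mult_minus_left)
  moreover have "(norm (\<eta> + e))\<^sup>2 = (norm \<eta>)\<^sup>2 + (2 * (\<eta> \<bullet> e) + (norm e)\<^sup>2)"
    by (simp add: power2_norm_eq_inner inner_add inner_commute)
  ultimately show ?thesis using cross by (simp add: inner_add algebra_simps)
qed

section \<open>Sampled states are values of a continuous trajectory\<close>

text \<open>
  Time invariance. On a segment \<open>[a, b]\<close> the input is constant only up to \<open>b\<close>, where the hold already
  shows its next value; a single point is negligible in the integral equation, so the shifted
  segment is a trajectory for an input that is constant on the closed interval.
\<close>

lemma trajectory_segment:
  fixes f :: "real^'n \<Rightarrow> real^'m \<Rightarrow> real^'n"
  assumes tr: "trajectory f T x0 u x" and ord: "0 \<le> a" "a \<le> b" "b \<le> T"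
    and uv: "\<And>s. a \<le> s \<Longrightarrow> s < b \<Longrightarrow> u s = v"
  shows "trajectory f (b - a) (x a) (\<lambda>_. v) (\<lambda>s. x (s + a))"
proof -
  let ?F = "\<lambda>s. f (x s) (u s)" and ?G = "\<lambda>s. f (x s) v"
  have F0: "?F absolutely_integrable_on {0..T}"
    and x_eq: "\<And>t. t \<in> {0..T} \<Longrightarrow> x t = x0 + integral {0..t} ?F"
    using tr unfolding trajectory_def by blast+
  have "?F absolutely_integrable_on {a..b}"
    using ord by (intro absolutely_integrable_on_subinterval[OF F0]) auto
  then have G: "?G absolutely_integrable_on {a..b}"
    by (rule absolutely_integrable_spike[where S = "{b}"]) (use uv in auto)
  have 1: "(\<lambda>s. ?G (s + a)) absolutely_integrable_on {0..b - a}"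
    using G integrable_shift_real_ivl[of ?G a b a]
      integrable_shift_real_ivl[of "\<lambda>s. norm (?G s)" a b a]
    by (simp add: absolutely_integrable_on_def)
  have 2: "x (t + a) = x a + integral {0..t} (\<lambda>s. ?G (s + a))" if t: "t \<in> {0..b - a}" for t
  proof -
    have "integral {0..a} ?F + integral {a..t + a} ?F = integral {0..t + a} ?F"
      using ord t F0 by (intro Henstock_Kurzweil_Integration.integral_combine)
        (auto simp: absolutely_integrable_on_def intro: integrable_subinterval_real)
    moreover have "x (t + a) = x0 + integral {0..t + a} ?F" "x a = x0 + integral {0..a} ?F"
      using x_eq[of "t + a"] x_eq[of a] ord t by auto
    ultimately have "x (t + a) = x a + integral {a..t + a} ?F"
      by (simp only: add.assoc)
    also have "integral {a..t + a} ?F = integral {a..t + a} ?G"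
      by (rule integral_spike[where S = "{b}"]) (use uv t in auto)
    also have "\<dots> = integral {0..t} (\<lambda>s. ?G (s + a))"
      using integral_shift_real_ivl[of a a "t + a" ?G] by simp
    finally show ?thesis .
  qed
  show ?thesis unfolding trajectory_def using 1 2 by blast
qed

lemma (in control_system) state_at_eqI:
  assumes "T > 0" "Adm T u" "trajectory f T x0 u x"
  shows "state_at f T x0 u = x T"
  unfolding state_at_def
proof (rule the_equality)
  show "\<exists>x'. trajectory f T x0 u x' \<and> x' T = x T" using assms by blast
next
  fix z assume "\<exists>x'. trajectory f T x0 u x' \<and> x' T = z"
  then show "z = x T" using trajectory_unique[OF assms(1,2)] assms by (metis atLeastAtMost_iff less_imp_le order_refl)
qed

lemma (in control_system) Adm_const:
  assumes "T > 0" "v \<in> U"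
  shows "Adm T (\<lambda>_. v)"
proof (rule adm_piecewise_constant)
  show "piecewise_constant_on T (\<lambda>_. v)" unfolding piecewise_constant_on_def
    by (rule exI[of _ 1], rule exI[of _ "\<lambda>i. real i * T"]) (use assms in auto)
qed (use assms in auto)

definition zero_order_hold :: "real \<Rightarrow> (nat \<Rightarrow> 'a) \<Rightarrow> 'a signal" where
  "zero_order_hold \<tau> u t = u (nat \<lfloor>t / \<tau>\<rfloor>)"

lemma zero_order_hold_eq:
  assumes "\<tau> > 0" "real i * \<tau> \<le> t" "t < real (Suc i) * \<tau>"
  shows "zero_order_hold \<tau> u t = u i"
proof -
  have "\<lfloor>t / \<tau>\<rfloor> = int i" using assms by (intro floor_unique) (auto simp: field_simps)
  then show ?thesis by (simp add: zero_order_hold_def)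
qed

lemma (in control_system) Adm_zero_order_hold:
  assumes "\<tau> > 0" "N > 0" "\<And>i. u i \<in> U"
  shows "Adm (real N * \<tau>) (zero_order_hold \<tau> u)"
proof (rule adm_piecewise_constant)
  have "\<forall>t\<in>{real i * \<tau>..<real (Suc i) * \<tau>}. zero_order_hold \<tau> u t = u i" for i
    using zero_order_hold_eq[OF assms(1)] by (metis atLeastLessThan_iff)
  then show "piecewise_constant_on (real N * \<tau>) (zero_order_hold \<tau> u)"
    unfolding piecewise_constant_on_def
    by (intro exI[of _ N] exI[of _ "\<lambda>i. real i * \<tau>"] conjI allI impI)
       (use assms(1) in auto)
qed (use assms in \<open>auto simp: zero_order_hold_def\<close>)

text \<open>
  Each period of the trajectory is, after a time shift, a trajectory under the constant input that
  defines the next sampled state, and trajectories are unique.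
\<close>

lemma (in control_system) sampled_run_eq_trajectory:
  assumes "\<tau> > 0" and run: "sampled_run U f h \<tau> u x y"
    and tr: "trajectory f (real N * \<tau>) (x 0) (zero_order_hold \<tau> u) \<xi>"
    and "i \<le> N"
  shows "\<xi> (real i * \<tau>) = x i"
  using \<open>i \<le> N\<close>
proof (induction i)
  case 0
  then show ?case using tr assms(1) by (simp add: trajectory_def)
next
  case (Suc i)
  let ?a = "real i * \<tau>" and ?b = "real (Suc i) * \<tau>"
  have "?b \<le> real N * \<tau>" using Suc.prems assms(1) by (intro mult_right_mono) auto
  then have "trajectory f (?b - ?a) (\<xi> ?a) (\<lambda>_. u i) (\<lambda>s. \<xi> (s + ?a))"
    using assms(1)
    by (intro trajectory_segment[OF tr] zero_order_hold_eq) (auto intro: mult_right_mono)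
  then have "trajectory f \<tau> (x i) (\<lambda>_. u i) (\<lambda>s. \<xi> (s + ?a))"
    using Suc by (simp add: algebra_simps)
  moreover have "Adm \<tau> (\<lambda>_. u i)"
    using run assms(1) by (intro Adm_const) (auto simp: sampled_run_def)
  ultimately have "state_at f \<tau> (x i) (\<lambda>_. u i) = \<xi> (\<tau> + ?a)"
    using state_at_eqI assms(1) by blast
  then show ?case using run by (simp add: sampled_run_def algebra_simps)
qed

section \<open>Dissipation over one and over many sampling periods\<close>

text \<open>
  The factor \<open>(b - a)\<^sup>2\<close> has two sources: one \<open>b - a\<close> is the Cauchy-Schwarz factor in the pointwise
  bound for the drift of \<open>h\<^sub>1\<close>, the other comes from integrating that bound over \<open>[a, b]\<close>.
\<close>

lemma dissipation_constant_input:
  fixes f :: "real^'n \<Rightarrow> real^'m \<Rightarrow> real^'n" and h1 :: "real^'n \<Rightarrow> real^'m"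
  assumes ofp: "IF_OFP f h Adm \<nu> \<rho> V"
    and T: "T > 0" "Adm T u" "trajectory f T x0 u x"
    and ord: "0 \<le> a" "a < b" "b \<le> T"
    and uv: "\<And>s. a \<le> s \<Longrightarrow> s < b \<Longrightarrow> u s = v"
    and hv: "\<And>\<xi>. h \<xi> v = h1 \<xi> + h2v"
    and y: "integral_of_derivative T (\<lambda>t. h1 (x t))"
    and sq: "(\<lambda>t. (norm (vector_derivative (\<lambda>s. h1 (x s)) (at t)))\<^sup>2) integrable_on {0..T}"
    and pos: "c > 0" "l > 0"
  shows "V (x b) - V (x a) \<le>
      (b - a) * (v \<bullet> h (x a) v - (\<nu> - c / 2) * (norm v)\<^sup>2 - (\<rho> - \<bar>\<rho>\<bar> / l) * (norm (h (x a) v))\<^sup>2)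
      + (1 / (2 * c) + \<bar>\<rho>\<bar> * (1 + l)) * (b - a)\<^sup>2 *
        integral {a..b} (\<lambda>t. (norm (vector_derivative (\<lambda>s. h1 (x s)) (at t)))\<^sup>2)"
proof -
  let ?I = "integral {a..b} (\<lambda>t. (norm (vector_derivative (\<lambda>s. h1 (x s)) (at t)))\<^sup>2)"
  let ?q = "v \<bullet> h (x a) v - (\<nu> - c / 2) * (norm v)\<^sup>2 - (\<rho> - \<bar>\<rho>\<bar> / l) * (norm (h (x a) v))\<^sup>2"
  let ?C = "1 / (2 * c) + \<bar>\<rho>\<bar> * (1 + l)"
  let ?s = "\<lambda>w t. w \<bullet> h (x t) w - \<nu> * (norm w)\<^sup>2 - \<rho> * (norm (h (x t) w))\<^sup>2"
  have cont: "continuous_on {a..b} (\<lambda>t. h1 (x t))"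
    using ord by (intro continuous_on_subset[OF integral_of_derivative_continuous_on[OF y]]) auto
  \<comment> \<open>With the input frozen at its held value the supply rate is continuous on the closed interval,
      although the actual one may jump at its right end.\<close>
  have int: "?s v integrable_on {a..b}"
    unfolding hv by (intro integrable_continuous_interval continuous_intros cont)
  have bound: "?s v t \<le> ?q + ?C * ((b - a) * ?I)" if t: "t \<in> {a..b}" for t
  proof -
    let ?e = "h1 (x t) - h1 (x a)"
    have e: "(norm ?e)\<^sup>2 \<le> (b - a) * ?I"
      using norm_increment_squared_le[OF y sq, of a t b] t ord by auto
    have "h (x t) v = h (x a) v + ?e" by (simp add: hv)
    then have "?s v t \<le> ?q + ?C * (norm ?e)\<^sup>2"
      using supply_rate_perturbed_output[OF pos] by metis
    also have "\<dots> \<le> ?q + ?C * ((b - a) * ?I)"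
      using pos by (intro add_left_mono mult_left_mono e) auto
    finally show ?thesis .
  qed
  have "V (x b) - V (x a) \<le> integral {a..b} (\<lambda>t. ?s (u t) t)"
    using ofp T ord unfolding IF_OFP_def by blast
  also have "\<dots> = integral {a..b} (?s v)"
    by (rule integral_spike[where S = "{b}"]) (use uv in auto)
  also have "\<dots> \<le> integral {a..b} (\<lambda>_. ?q + ?C * ((b - a) * ?I))"
    using bound by (intro integral_le int integrable_const_ivl) auto
  also have "\<dots> = (b - a) * ?q + ?C * (b - a)\<^sup>2 * ?I"
  proof -
    have "(b - a) * (q + C * ((b - a) * I)) = (b - a) * q + C * (b - a)\<^sup>2 * I" for q C I
      by (simp add: power2_eq_square algebra_simps)
    then show ?thesis using ord by simp
  qed
  finally show ?thesis .
qed

text \<open>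
  The storage increments telescope over the periods, and the output rate bound is used only once, over
  the whole horizon, so that \<open>\<beta>\<close> is charged a single time.
\<close>

lemma sampled_dissipation:
  fixes h1 :: "real^'n \<Rightarrow> real^'m" and h2 :: "real^'m \<Rightarrow> real^'m"
  assumes \<tau>: "\<tau> > 0"
    and sys: "control_system U f h Adm"
    and additive: "\<And>\<xi> v. v \<in> U \<Longrightarrow> h \<xi> v = h1 \<xi> + h2 v"
    and \<gamma>: "\<gamma> > 0"
    and rate: "output_rate_bound f Adm h1 \<gamma> \<beta>"
    and ofp: "IF_OFP f h Adm \<nu> \<rho> V"
    and l: "l > 0"
    and run: "sampled_run U f h \<tau> u x y"
    and N: "N > 0"
  shows "(V (x N) - V (x 0)) / \<tau> \<le> (\<bar>\<rho>\<bar> * \<tau> * (1 + l) + 1 / (2 * \<gamma>)) * \<beta> (x 0)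
    + (\<Sum>k<N. u k \<bullet> y k - (\<nu> - \<tau> * \<gamma> - \<tau>\<^sup>2 * \<gamma>\<^sup>2 * (1 + l) * \<bar>\<rho>\<bar>) * (norm (u k))\<^sup>2
        - (\<rho> - \<bar>\<rho>\<bar> / l) * (norm (y k))\<^sup>2)"
proof -
  interpret control_system U f h Adm by (rule sys)
  let ?T = "real N * \<tau>" and ?u = "zero_order_hold \<tau> u"
  have T: "?T > 0" using \<tau> N by simp
  have U: "u i \<in> U" and y_eq: "y i = h (x i) (u i)" for i
    using run by (auto simp: sampled_run_def)
  have adm: "Adm ?T ?u" using \<tau> N U by (intro Adm_zero_order_hold)
  then obtain \<xi> where tr: "trajectory f ?T (x 0) ?u \<xi>" using trajectory_exists T by blast
  have \<xi>: "\<xi> (real i * \<tau>) = x i" if "i \<le> N" for i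
    using sampled_run_eq_trajectory[OF \<tau> run tr that] .
  let ?D = "\<lambda>t. (norm (vector_derivative (\<lambda>s. h1 (\<xi> s)) (at t)))\<^sup>2"
  define A where "A = (\<Sum>k<N. (norm (u k))\<^sup>2)"
  define B where "B = (\<Sum>k<N. (norm (y k))\<^sup>2)"
  define P where "P = (\<Sum>k<N. u k \<bullet> y k)"
  have deriv: "integral_of_derivative ?T (\<lambda>t. h1 (\<xi> t))" and sq: "?D integrable_on {0..?T}"
    and D_le: "integral {0..?T} ?D \<le> \<gamma>\<^sup>2 * integral {0..?T} (\<lambda>t. (norm (?u t))\<^sup>2) + \<beta> (x 0)"
    using rate T adm tr unfolding output_rate_bound_def by blast+
  have grid: "real i * \<tau> < real (Suc i) * \<tau>" "real (Suc i) * \<tau> \<le> ?T" if "i < N" for i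
    using \<tau> that by (auto intro: mult_right_mono)
  have "((\<lambda>t. (norm (?u t))\<^sup>2) has_integral (\<Sum>i<N. \<tau> * (norm (u i))\<^sup>2)) {0..?T}"
  proof (rule has_integral_equal_steps)
    fix i
    let ?a = "real i * \<tau>" and ?b = "real (Suc i) * \<tau>"
    have "((\<lambda>_. (norm (u i))\<^sup>2) has_integral \<tau> * (norm (u i))\<^sup>2) {?a..?b}"
      using has_integral_const_real[of "(norm (u i))\<^sup>2" ?a ?b] \<tau> by (simp add: algebra_simps)
    then show "((\<lambda>t. (norm (?u t))\<^sup>2) has_integral \<tau> * (norm (u i))\<^sup>2) {?a..?b}"
      by (rule has_integral_spike[of "{?b}", rotated 2])
        (use \<tau> zero_order_hold_eq[of \<tau> i _ u] in auto)
  qed (use \<tau> in auto)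
  then have u_int: "integral {0..?T} (\<lambda>t. (norm (?u t))\<^sup>2) = \<tau> * A"
    by (simp add: integral_unique A_def sum_distrib_left)
  have "(?D has_integral (\<Sum>i<N. integral {real i * \<tau>..real (Suc i) * \<tau>} ?D)) {0..?T}"
    using \<tau> grid
    by (intro has_integral_equal_steps integrable_integral integrable_subinterval_real[OF sq]) auto
  then have D_sum: "(\<Sum>i<N. integral {real i * \<tau>..real (Suc i) * \<tau>} ?D) = integral {0..?T} ?D"
    by (rule integral_unique[symmetric])
  \<comment> \<open>The coefficient of the squared drift for the weight \<open>\<tau> * \<gamma>\<close> on the input.\<close>
  define C where "C = 1 / (2 * (\<tau> * \<gamma>)) + \<bar>\<rho>\<bar> * (1 + l)"
  have "C \<ge> 0" using \<tau> \<gamma> l by (simp add: C_def)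
  have period: "V (x (Suc i)) - V (x i) \<le>
      \<tau> * (u i \<bullet> y i - (\<nu> - \<tau> * \<gamma> / 2) * (norm (u i))\<^sup>2 - (\<rho> - \<bar>\<rho>\<bar> / l) * (norm (y i))\<^sup>2)
      + C * \<tau>\<^sup>2 * integral {real i * \<tau>..real (Suc i) * \<tau>} ?D" if i: "i < N" for i
  proof -
    let ?a = "real i * \<tau>" and ?b = "real (Suc i) * \<tau>"
    have len: "?b - ?a = \<tau>" by (simp add: algebra_simps)
    have "0 \<le> ?a" and c: "\<tau> * \<gamma> > 0" using \<tau> \<gamma> by auto
    from dissipation_constant_input[OF ofp T adm tr this(1) grid[OF i] zero_order_hold_eq[OF \<tau>]
        additive[OF U] deriv sq c l]
    show ?thesis unfolding len C_def using \<xi>[of i] \<xi>[of "Suc i"] i y_eq by simp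
  qed
  have "V (x N) - V (x 0) = (\<Sum>i<N. V (x (Suc i)) - V (x i))"
    by (rule sum_lessThan_telescope[of "\<lambda>i. V (x i)", symmetric])
  also have "\<dots> \<le> (\<Sum>i<N. \<tau> * (u i \<bullet> y i - (\<nu> - \<tau> * \<gamma> / 2) * (norm (u i))\<^sup>2
      - (\<rho> - \<bar>\<rho>\<bar> / l) * (norm (y i))\<^sup>2) + C * \<tau>\<^sup>2 * integral {real i * \<tau>..real (Suc i) * \<tau>} ?D)"
    by (intro sum_mono period) auto
  also have "\<dots> = \<tau> * (P - (\<nu> - \<tau> * \<gamma> / 2) * A - (\<rho> - \<bar>\<rho>\<bar> / l) * B)
      + C * \<tau>\<^sup>2 * integral {0..?T} ?D"
    unfolding A_def B_def P_def D_sum[symmetric]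
    by (simp add: sum.distrib sum_subtractf sum_distrib_left right_diff_distrib)
  also have "\<dots> \<le> \<tau> * (P - (\<nu> - \<tau> * \<gamma> / 2) * A - (\<rho> - \<bar>\<rho>\<bar> / l) * B)
      + C * \<tau>\<^sup>2 * (\<gamma>\<^sup>2 * (\<tau> * A) + \<beta> (x 0))"
    using D_le \<open>C \<ge> 0\<close> unfolding u_int by (intro add_left_mono mult_left_mono) auto
  also have "\<dots> = \<tau> * ((\<bar>\<rho>\<bar> * \<tau> * (1 + l) + 1 / (2 * \<gamma>)) * \<beta> (x 0)
      + (P - (\<nu> - \<tau> * \<gamma> - \<tau>\<^sup>2 * \<gamma>\<^sup>2 * (1 + l) * \<bar>\<rho>\<bar>) * A - (\<rho> - \<bar>\<rho>\<bar> / l) * B))"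
  proof -
    have "C * \<tau>\<^sup>2 = \<tau> * (1 / (2 * \<gamma>) + \<bar>\<rho>\<bar> * (1 + l) * \<tau>)"
      using \<tau> \<gamma> by (simp add: C_def field_simps power2_eq_square)
    moreover have "\<gamma>\<^sup>2 * (\<tau> * A) / (2 * \<gamma>) = \<tau> * \<gamma> / 2 * A"
      using \<gamma> by (simp add: field_simps power2_eq_square)
    ultimately show ?thesis by (simp add: algebra_simps power2_eq_square)
  qed
  finally have "(V (x N) - V (x 0)) / \<tau> \<le> (\<bar>\<rho>\<bar> * \<tau> * (1 + l) + 1 / (2 * \<gamma>)) * \<beta> (x 0)
      + (P - (\<nu> - \<tau> * \<gamma> - \<tau>\<^sup>2 * \<gamma>\<^sup>2 * (1 + l) * \<bar>\<rho>\<bar>) * A - (\<rho> - \<bar>\<rho>\<bar> / l) * B)"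
    using \<tau> by (simp add: divide_le_eq mult.commute)
  then show ?thesis
    by (simp add: A_def B_def P_def sum_subtractf sum_distrib_left)
qed

theorem theorem1:
  fixes U :: "(real^'m) set"
    and f :: "real^'n \<Rightarrow> real^'m \<Rightarrow> real^'n"
    and h :: "real^'n \<Rightarrow> real^'m \<Rightarrow> real^'m"
    and Adm :: "real \<Rightarrow> (real^'m) signal \<Rightarrow> bool"
    and h1 :: "real^'n \<Rightarrow> real^'m"
    and h2 :: "real^'m \<Rightarrow> real^'m"
    and V \<beta> :: "real^'n \<Rightarrow> real"
    and \<tau> \<gamma> \<nu> \<rho> l1 :: real
    and u y :: "nat \<Rightarrow> real^'m"
    and x :: "nat \<Rightarrow> real^'n"
    and k0 k1 :: nat
  assumes "\<tau> > 0"
    and "control_system U f h Adm"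
    and "\<And>\<xi> v. v \<in> U \<Longrightarrow> h \<xi> v = h1 \<xi> + h2 v"
    and "\<gamma> > 0"
    and "\<And>\<xi>. \<beta> \<xi> \<ge> 0"
    and "\<beta> 0 = 0"
    and "output_rate_bound f Adm h1 \<gamma> \<beta>"
    and "IF_OFP f h Adm \<nu> \<rho> V"
    and "l1 > 0"
    and "sampled_run U f h \<tau> u x y"
    and "k0 < k1"
  shows "let V' = (\<lambda>\<xi>. 1 / \<tau> * V \<xi>);
             \<nu>' = \<nu> - \<tau> * \<gamma> - \<tau>\<^sup>2 * \<gamma>\<^sup>2 * (1 + l1) * \<bar>\<rho>\<bar>;
             \<rho>' = \<rho> - \<bar>\<rho>\<bar> / l1;
             w = \<bar>\<rho>\<bar> * \<tau> * (1 + l1) + 1 / \<gamma>;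
             \<delta> = (\<lambda>\<xi>. w * \<beta> \<xi>)
         in V' (x k1) - V' (x k0) \<le>
              \<delta> (x k0) + (\<Sum>k = k0..<k1. u k \<bullet> y k - \<nu>' * (norm (u k))\<^sup>2 - \<rho>' * (norm (y k))\<^sup>2)"
proof -
  define N where "N = k1 - k0"
  have N: "N > 0" "k1 = k0 + N" using assms(11) by (auto simp: N_def)
  let ?q = "\<lambda>k. u k \<bullet> y k - (\<nu> - \<tau> * \<gamma> - \<tau>\<^sup>2 * \<gamma>\<^sup>2 * (1 + l1) * \<bar>\<rho>\<bar>) * (norm (u k))\<^sup>2
        - (\<rho> - \<bar>\<rho>\<bar> / l1) * (norm (y k))\<^sup>2"
  \<comment> \<open>The sampled system is time invariant, so the run may be restarted at \<open>k0\<close>.\<close>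
  have "sampled_run U f h \<tau> (\<lambda>i. u (k0 + i)) (\<lambda>i. x (k0 + i)) (\<lambda>i. y (k0 + i))"
    using assms(10) by (simp add: sampled_run_def)
  from sampled_dissipation[OF assms(1,2,3,4,7,8,9) this N(1)]
  have "(V (x k1) - V (x k0)) / \<tau> \<le>
      (\<bar>\<rho>\<bar> * \<tau> * (1 + l1) + 1 / (2 * \<gamma>)) * \<beta> (x k0) + (\<Sum>i<N. ?q (k0 + i))"
    by (simp add: N)
  also have "(\<Sum>i<N. ?q (k0 + i)) = (\<Sum>k = k0..<k1. ?q k)"
    using sum.shift_bounds_nat_ivl[of ?q 0 k0 N] by (simp add: N atLeast0LessThan add.commute)
  also have "(\<bar>\<rho>\<bar> * \<tau> * (1 + l1) + 1 / (2 * \<gamma>)) * \<beta> (x k0)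
      \<le> (\<bar>\<rho>\<bar> * \<tau> * (1 + l1) + 1 / \<gamma>) * \<beta> (x k0)"
    using assms(4,5) by (intro mult_right_mono) (auto simp: field_simps)
  finally show ?thesis by (simp add: Let_def diff_divide_distrib)
qed

end
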